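(* On $\mathrm{SL}_2(\mathbb{C}) = \left\{ \begin{pmatrix} a & b \\ c & d \end{pmatrix} : a,b,c,d \in \mathbb{C},\ ad - bc = 1 \right\}$ consider the vector fields $$V = c \frac{\partial}{\partial a} + d \frac{\partial}{\partial b}, \qquad W = a \frac{\partial}{\partial c} + b \frac{\partial}{\partial d}.$$ The four complete vector fields $V$, $W$, $(b+c)W$, $dW$ generate the Lie algebra of all polynomial vector fields on $\mathrm{SL}_2(\mathbb{C})$.
   Context: A polynomial (algebraic) vector field on the affine variety $\mathrm{SL}_2(\mathbb{C})$ is a $\mathbb{C}$-linear derivation of its coordinate ring $\mathbb{C}[a,b,c,d]/(ad-bc-1)$; the Lie bracket is the commutator of derivations. The vector fields $V, W$ are tangent to $\mathrm{SL}_2(\mathbb{C})$ and are regarded as vector fields on it. "Generate" means generate as a complex Lie algebra (the smallest complex Lie subalgebra containing the given fields). A holomorphic vector field is called complete if its flow exists for all complex times $t \in \mathbb{C}$. *)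

theory Defs
  imports "HOL-Analysis.Analysis" "HOL-Library.Poly_Mapping"
begin

text \<open>Polynomials over the complex numbers in the four entries of a 2 by 2 matrix; the pair
  \<open>(i, j)\<close> indexes the entry in row \<open>i\<close> and column \<open>j\<close>.\<close>

type_synonym mat_poly = "(2 \<times> 2 \<Rightarrow>\<^sub>0 nat) \<Rightarrow>\<^sub>0 complex"

definition Const :: "complex \<Rightarrow> mat_poly" where
  "Const c = Poly_Mapping.single 0 c"

definition Var :: "2 \<times> 2 \<Rightarrow> mat_poly" where
  "Var x = Poly_Mapping.single (Poly_Mapping.single x 1) 1"

definition partial :: "2 \<times> 2 \<Rightarrow> mat_poly \<Rightarrow> mat_poly" where
  "partial x p = (\<Sum>m\<in>Poly_Mapping.keys p.
     Poly_Mapping.single (m - Poly_Mapping.single x 1)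
       (of_nat (Poly_Mapping.lookup m x) * Poly_Mapping.lookup p m))"

definition poly_eval :: "complex^2^2 \<Rightarrow> mat_poly \<Rightarrow> complex" where
  "poly_eval M p = (\<Sum>m\<in>Poly_Mapping.keys p.
     Poly_Mapping.lookup p m * (\<Prod>(i, j)\<in>UNIV. (M $ i $ j) ^ Poly_Mapping.lookup m (i, j)))"

definition det_rel :: mat_poly where
  "det_rel = Var (1, 1) * Var (2, 2) - Var (1, 2) * Var (2, 1) - 1"

lemma mat_poly_induct [case_names zero single add]:
  fixes p :: mat_poly
  assumes "P 0" "\<And>m c. P (Poly_Mapping.single m c)" "\<And>p q. P p \<Longrightarrow> P q \<Longrightarrow> P (p + q)"
  shows "P p"
proof (induction p rule: update_induct)
  case const
  show ?case by (rule assms(1))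
next
  case (update f a b)
  have "Poly_Mapping.update a b f = Poly_Mapping.single a b + f"
    using update(1)
    by (intro poly_mapping_eqI)
       (auto simp: lookup_update lookup_add lookup_single when_def in_keys_iff)
  then show ?case by (simp add: assms(2,3) update.IH)
qed

lemma sum_keys_superset:
  fixes g :: "'a \<Rightarrow> 'b::zero \<Rightarrow> 'c::comm_monoid_add"
  assumes "\<And>m. g m 0 = 0" "finite S" "Poly_Mapping.keys p \<subseteq> S"
  shows "(\<Sum>m\<in>Poly_Mapping.keys p. g m (Poly_Mapping.lookup p m)) =
    (\<Sum>m\<in>S. g m (Poly_Mapping.lookup p m))"
  by (rule sum.mono_neutral_left) (use assms in \<open>auto simp: in_keys_iff\<close>)

lemma sum_keys_add:
  fixes g :: "'a \<Rightarrow> 'b::monoid_add \<Rightarrow> 'c::comm_monoid_add"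
  assumes "\<And>m. g m 0 = 0" "\<And>m c d. g m (c + d) = g m c + g m d"
  shows "(\<Sum>m\<in>Poly_Mapping.keys (p + q). g m (Poly_Mapping.lookup (p + q) m)) =
    (\<Sum>m\<in>Poly_Mapping.keys p. g m (Poly_Mapping.lookup p m)) +
    (\<Sum>m\<in>Poly_Mapping.keys q. g m (Poly_Mapping.lookup q m))"
proof -
  let ?S = "Poly_Mapping.keys p \<union> Poly_Mapping.keys q"
  have "finite ?S" by simp
  then show ?thesis
    using sum_keys_superset[of g ?S p] sum_keys_superset[of g ?S q]
      sum_keys_superset[of g ?S "p + q"] Poly_Mapping.keys_add[of p q] assms(1)
    by (simp add: lookup_add assms(2) sum.distrib)
qed

lemma sum_keys_single:
  fixes g :: "'a \<Rightarrow> 'b::zero \<Rightarrow> 'c::comm_monoid_add"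
  assumes "\<And>m. g m 0 = 0"
  shows "(\<Sum>k\<in>Poly_Mapping.keys (Poly_Mapping.single m c).
    g k (Poly_Mapping.lookup (Poly_Mapping.single m c) k)) = g m c"
  using assms by simp

lemma partial_add: "partial x (p + q) = partial x p + partial x q"
  unfolding partial_def by (rule sum_keys_add) (simp_all add: single_add algebra_simps)

lemma partial_single:
  "partial x (Poly_Mapping.single m c) =
    Poly_Mapping.single (m - Poly_Mapping.single x 1) (of_nat (Poly_Mapping.lookup m x) * c)"
  unfolding partial_def by (rule sum_keys_single) simp

lemma partial_0: "partial x 0 = 0"
  by (simp add: partial_def)

lemma partial_1: "partial x 1 = 0"
  unfolding single_one[symmetric] partial_single by simp

lemma partial_Const: "partial x (Const c) = 0"
  by (simp add: Const_def partial_single)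

lemma partial_Var: "partial x (Var y) = (if x = y then 1 else 0)"
  by (simp add: Var_def partial_single lookup_single when_def single_one)

lemma partial_uminus: "partial x (- p) = - partial x p"
  using partial_add[of x p "- p"] by (simp add: partial_0 eq_neg_iff_add_eq_0 add.commute)

lemma partial_diff: "partial x (p - q) = partial x p - partial x q"
  using partial_add[of x p "- q"] by (simp add: partial_uminus)

lemma minus_single_add:
  assumes "Poly_Mapping.lookup (m :: 'a \<Rightarrow>\<^sub>0 nat) x \<noteq> 0"
  shows "m + n - Poly_Mapping.single x 1 = (m - Poly_Mapping.single x 1) + n"
  using assms by (intro poly_mapping_eqI) (auto simp: lookup_minus lookup_add lookup_single when_def)

lemma partial_mult: "partial x (p * q) = partial x p * q + p * partial x q"
proof (induction p rule: mat_poly_induct)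
  case (single m c)
  show ?case
  proof (induction q rule: mat_poly_induct)
    case (single n d)
    let ?e = "Poly_Mapping.single x (1::nat)"
    have 1: "Poly_Mapping.single (m + n - ?e) (of_nat (Poly_Mapping.lookup m x) * (c * d)) =
        Poly_Mapping.single ((m - ?e) + n) (of_nat (Poly_Mapping.lookup m x) * c * d)"
      using minus_single_add[of m x n]
      by (cases "Poly_Mapping.lookup m x = 0") (simp_all add: mult.assoc)
    have 2: "Poly_Mapping.single (m + n - ?e) (of_nat (Poly_Mapping.lookup n x) * (c * d)) =
        Poly_Mapping.single (m + (n - ?e)) (c * (of_nat (Poly_Mapping.lookup n x) * d))"
      using minus_single_add[of n x m]
      by (cases "Poly_Mapping.lookup n x = 0") (simp_all add: add.commute mult.left_commute)
    show ?case
      using 1 2 by (simp add: mult_single partial_single lookup_add distrib_right single_add)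
  qed (simp_all add: partial_0 partial_add algebra_simps)
qed (simp_all add: partial_0 partial_add algebra_simps)

lemma poly_eval_add: "poly_eval M (p + q) = poly_eval M p + poly_eval M q"
  unfolding poly_eval_def by (rule sum_keys_add) (simp_all add: algebra_simps)

lemma poly_eval_single:
  "poly_eval M (Poly_Mapping.single m c) =
    c * (\<Prod>(i, j)\<in>UNIV. (M $ i $ j) ^ Poly_Mapping.lookup m (i, j))"
  unfolding poly_eval_def by (rule sum_keys_single) simp

lemma poly_eval_0: "poly_eval M 0 = 0"
  by (simp add: poly_eval_def)

lemma poly_eval_1: "poly_eval M 1 = 1"
  unfolding single_one[symmetric] poly_eval_single by (simp add: case_prod_beta)

lemma poly_eval_uminus: "poly_eval M (- p) = - poly_eval M p"
  using poly_eval_add[of M p "- p"] by (simp add: poly_eval_0 eq_neg_iff_add_eq_0 add.commute)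

lemma poly_eval_diff: "poly_eval M (p - q) = poly_eval M p - poly_eval M q"
  using poly_eval_add[of M p "- q"] by (simp add: poly_eval_uminus)

lemma poly_eval_mult: "poly_eval M (p * q) = poly_eval M p * poly_eval M q"
proof (induction p rule: mat_poly_induct)
  case (single m c)
  show ?case
  proof (induction q rule: mat_poly_induct)
    case (single n d)
    show ?case
      by (simp add: mult_single poly_eval_single lookup_add power_add case_prod_beta
          prod.distrib mult_ac)
  qed (simp_all add: poly_eval_0 poly_eval_add algebra_simps)
qed (simp_all add: poly_eval_0 poly_eval_add algebra_simps)

lemma poly_eval_Const: "poly_eval M (Const c) = c"
  by (simp add: Const_def poly_eval_single case_prod_beta)

lemma poly_eval_Var: "poly_eval M (Var (i, j)) = M $ i $ j"
proof -
  have "(case y of (k, l) \<Rightarrow> (M $ k $ l) ^ Poly_Mapping.lookup (Poly_Mapping.single (i, j) (1::nat)) (k, l))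
      = (if y = (i, j) then M $ i $ j else 1)" for y
    by (cases "y = (i, j)") (auto simp: lookup_single when_def split: prod.split)
  then show ?thesis by (simp add: Var_def poly_eval_single)
qed

lemma poly_eval_det_rel: "poly_eval M det_rel = det M - 1"
  by (simp add: det_rel_def poly_eval_diff poly_eval_mult poly_eval_Var poly_eval_1 det_2)

text \<open>The coordinate ring \<open>\<complex>[a,b,c,d]/(ad - bc - 1)\<close>.\<close>

definition reg_cong :: "mat_poly \<Rightarrow> mat_poly \<Rightarrow> bool" where
  "reg_cong p q \<longleftrightarrow> det_rel dvd p - q"

lemma equivp_reg_cong: "equivp reg_cong"
proof (rule equivpI)
  show "reflp reg_cong"
    by (auto simp: reflp_def reg_cong_def)
  show "symp reg_cong"
    unfolding symp_def reg_cong_def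
  proof (intro allI impI)
    fix p q :: mat_poly
    assume "det_rel dvd p - q"
    then have "det_rel dvd - (p - q)" by (simp only: dvd_minus_iff)
    then show "det_rel dvd q - p" by simp
  qed
  show "transp reg_cong"
    unfolding transp_def reg_cong_def
  proof (intro allI impI)
    fix p q r :: mat_poly
    assume "det_rel dvd p - q" "det_rel dvd q - r"
    then have "det_rel dvd (p - q) + (q - r)" by (rule dvd_add)
    then show "det_rel dvd p - r" by simp
  qed
qed

quotient_type reg = mat_poly / reg_cong
  by (rule equivp_reg_cong)

instantiation reg :: comm_ring_1
begin

lift_definition zero_reg :: reg is 0 .

lift_definition one_reg :: reg is 1 .

lift_definition plus_reg :: "reg \<Rightarrow> reg \<Rightarrow> reg" is "(+)"
  unfolding reg_cong_def add_diff_add by (rule dvd_add)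

lift_definition uminus_reg :: "reg \<Rightarrow> reg" is uminus
  unfolding reg_cong_def minus_diff_minus by (simp only: dvd_minus_iff)

lift_definition minus_reg :: "reg \<Rightarrow> reg \<Rightarrow> reg" is "(-)"
  unfolding reg_cong_def
proof -
  fix p p' q q' :: mat_poly
  assume "det_rel dvd p - p'" "det_rel dvd q - q'"
  then have "det_rel dvd (p - p') - (q - q')" by (rule dvd_diff)
  then show "det_rel dvd (p - q) - (p' - q')" by (simp add: algebra_simps)
qed

lift_definition times_reg :: "reg \<Rightarrow> reg \<Rightarrow> reg" is "(*)"
  unfolding reg_cong_def
proof -
  fix p p' q q' :: mat_poly
  assume "det_rel dvd p - p'" "det_rel dvd q - q'"
  then have "det_rel dvd (p - p') * q + p' * (q - q')"
    by (intro dvd_add dvd_mult dvd_mult2)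
  then show "det_rel dvd p * q - p' * q'"
    by (simp add: algebra_simps)
qed

instance
proof
  show "(0::reg) \<noteq> 1"
  proof (transfer, rule notI)
    assume "reg_cong 0 1"
    then obtain k where "0 - 1 = det_rel * k"
      unfolding reg_cong_def dvd_def by blast
    then have "poly_eval (mat 1) (0 - 1) = poly_eval (mat 1) (det_rel * k)"
      by simp
    then show False
      by (simp add: poly_eval_diff poly_eval_mult poly_eval_0 poly_eval_1 poly_eval_det_rel
          poly_eval_uminus)
  qed
qed (transfer; simp add: reg_cong_def algebra_simps)+

end

lift_definition const_reg :: "complex \<Rightarrow> reg" is Const .

lift_definition entry :: "2 \<Rightarrow> 2 \<Rightarrow> reg" is "\<lambda>i j. Var (i, j)" .

definition scale_reg :: "complex \<Rightarrow> reg \<Rightarrow> reg" where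
  "scale_reg c f = const_reg c * f"

lemma const_reg_add: "const_reg (c + d) = const_reg c + const_reg d"
  by transfer (simp add: Const_def single_add reg_cong_def)

lemma const_reg_mult: "const_reg (c * d) = const_reg c * const_reg d"
  by transfer (simp add: Const_def mult_single reg_cong_def)

lemma const_reg_1: "const_reg 1 = 1"
  by transfer (simp add: Const_def reg_cong_def)

interpretation reg: vector_space scale_reg
  by unfold_locales
     (simp_all add: scale_reg_def const_reg_add const_reg_mult const_reg_1 algebra_simps)

text \<open>Vector fields are the \<open>\<complex>\<close>-linear derivations of the coordinate ring.\<close>

definition vector_fields :: "(reg \<Rightarrow> reg) set" where
  "vector_fields = {X. Vector_Spaces.linear scale_reg scale_reg X \<and>
     (\<forall>f g. X (f * g) = X f * g + f * X g)}"

definition lie_bracket :: "(reg \<Rightarrow> reg) \<Rightarrow> (reg \<Rightarrow> reg) \<Rightarrow> reg \<Rightarrow> reg" where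
  "lie_bracket X Y = (\<lambda>f. X (Y f) - Y (X f))"

definition lie_subalgebra :: "(reg \<Rightarrow> reg) set \<Rightarrow> bool" where
  "lie_subalgebra L \<longleftrightarrow> L \<subseteq> vector_fields \<and> (\<lambda>f. 0) \<in> L \<and>
     (\<forall>X\<in>L. \<forall>Y\<in>L. (\<lambda>f. X f + Y f) \<in> L) \<and>
     (\<forall>c. \<forall>X\<in>L. (\<lambda>f. scale_reg c (X f)) \<in> L) \<and>
     (\<forall>X\<in>L. \<forall>Y\<in>L. lie_bracket X Y \<in> L)"

definition lie_generated :: "(reg \<Rightarrow> reg) set \<Rightarrow> (reg \<Rightarrow> reg) set" where
  "lie_generated S = \<Inter>{L. lie_subalgebra L \<and> S \<subseteq> L}"

definition mult_field :: "reg \<Rightarrow> (reg \<Rightarrow> reg) \<Rightarrow> reg \<Rightarrow> reg" where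
  "mult_field h X = (\<lambda>f. h * X f)"

text \<open>The fields \<open>c \<partial>/\<partial>a + d \<partial>/\<partial>b\<close> and \<open>a \<partial>/\<partial>c + b \<partial>/\<partial>d\<close> on the affine space of matrices
  annihilate \<open>ad - bc - 1\<close>, hence act on the coordinate ring.\<close>

definition poly_V :: "mat_poly \<Rightarrow> mat_poly" where
  "poly_V p = Var (2, 1) * partial (1, 1) p + Var (2, 2) * partial (1, 2) p"

definition poly_W :: "mat_poly \<Rightarrow> mat_poly" where
  "poly_W p = Var (1, 1) * partial (2, 1) p + Var (1, 2) * partial (2, 2) p"

lemma poly_V_det_rel: "poly_V det_rel = 0"
  by (simp add: poly_V_def det_rel_def partial_diff partial_mult partial_Var partial_1)

lemma poly_W_det_rel: "poly_W det_rel = 0"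
  by (simp add: poly_W_def det_rel_def partial_diff partial_mult partial_Var partial_1)

lemma poly_V_dvd: "det_rel dvd p \<Longrightarrow> det_rel dvd poly_V p"
proof (elim dvdE)
  fix k
  have "poly_V (det_rel * k) = poly_V det_rel * k + det_rel * poly_V k"
    by (simp add: poly_V_def partial_mult algebra_simps)
  moreover assume "p = det_rel * k"
  ultimately show ?thesis by (simp add: poly_V_det_rel)
qed

lemma poly_W_dvd: "det_rel dvd p \<Longrightarrow> det_rel dvd poly_W p"
proof (elim dvdE)
  fix k
  have "poly_W (det_rel * k) = poly_W det_rel * k + det_rel * poly_W k"
    by (simp add: poly_W_def partial_mult algebra_simps)
  moreover assume "p = det_rel * k"
  ultimately show ?thesis by (simp add: poly_W_det_rel)
qed

lift_definition field_V :: "reg \<Rightarrow> reg" is poly_V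
  unfolding reg_cong_def
proof -
  fix p q
  assume "det_rel dvd p - q"
  moreover have "poly_V p - poly_V q = poly_V (p - q)"
    by (simp add: poly_V_def partial_diff algebra_simps)
  ultimately show "det_rel dvd poly_V p - poly_V q" by (simp add: poly_V_dvd)
qed

lift_definition field_W :: "reg \<Rightarrow> reg" is poly_W
  unfolding reg_cong_def
proof -
  fix p q
  assume "det_rel dvd p - q"
  moreover have "poly_W p - poly_W q = poly_W (p - q)"
    by (simp add: poly_W_def partial_diff algebra_simps)
  ultimately show "det_rel dvd poly_W p - poly_W q" by (simp add: poly_W_dvd)
qed

lemma field_V_entry:
  "field_V (entry 1 1) = entry 2 1" "field_V (entry 1 2) = entry 2 2"
  "field_V (entry 2 1) = 0" "field_V (entry 2 2) = 0"
  by (transfer; simp add: poly_V_def partial_Var reg_cong_def)+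

lemma field_W_entry:
  "field_W (entry 1 1) = 0" "field_W (entry 1 2) = 0"
  "field_W (entry 2 1) = entry 1 1" "field_W (entry 2 2) = entry 1 2"
  by (transfer; simp add: poly_W_def partial_Var reg_cong_def)+

typedef sl2 = "{M :: complex^2^2. det M = 1}"
  by (rule exI[of _ "mat 1"]) simp

setup_lifting type_definition_sl2

lift_definition reg_eval :: "sl2 \<Rightarrow> reg \<Rightarrow> complex" is poly_eval
proof -
  fix M :: "complex^2^2" and p q
  assume M: "det M = 1" and "reg_cong p q"
  then obtain k where "p - q = det_rel * k"
    unfolding reg_cong_def dvd_def by blast
  then have "poly_eval M p - poly_eval M q = poly_eval M (det_rel * k)"
    by (simp flip: poly_eval_diff)
  then show "poly_eval M p = poly_eval M q"
    by (simp add: poly_eval_mult poly_eval_det_rel M)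
qed

text \<open>\<open>\<phi> t x\<close> is the value at complex time \<open>t\<close> of the flow of \<open>X\<close> started at \<open>x\<close>.  The flow
  equation is stated on regular functions; on the four entries it is the usual system of
  differential equations for the entries of \<open>\<phi> t x\<close>.\<close>

definition complete_field :: "(reg \<Rightarrow> reg) \<Rightarrow> bool" where
  "complete_field X \<longleftrightarrow> (\<exists>\<phi> :: complex \<Rightarrow> sl2 \<Rightarrow> sl2. \<forall>x. \<phi> 0 x = x \<and>
     (\<forall>t f. ((\<lambda>s. reg_eval (\<phi> s x) f) has_field_derivative reg_eval (\<phi> t x) (X f)) (at t)))"

end

theory Submission
  imports Defs
begin

text \<open>Put \<open>H = [V, W]\<close>. The fields \<open>V\<close>, \<open>W\<close>, \<open>H\<close> form an \<open>sl\<^sub>2\<close>-triple of right-invariant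
  fields, and since \<open>ad - bc = 1\<close> they are a basis of the module of vector fields over the coordinate
  ring (\<open>vector_field_frame\<close>). So it suffices that a Lie algebra \<open>L\<close> containing the four
  fields contains \<open>hV\<close>, \<open>hW\<close> and \<open>hH\<close> for every regular function \<open>h\<close>.

  Let \<open>J\<close> be the space of those \<open>h\<close> with \<open>hH \<in> L\<close>. The identity \<open>[V, hH] = V(h)H - 2hV\<close> and its
  analogue for \<open>W\<close> show that \<open>hV\<close> and \<open>hW\<close> lie in \<open>L\<close> once \<open>h\<close>, \<open>V(h)\<close> and \<open>W(h)\<close> lie in \<open>J\<close>, so
  everything reduces to showing that \<open>J\<close> is the whole coordinate ring. The engine is a grading:
  \<open>H\<close> acts with eigenvalue \<open>-1\<close> on \<open>a\<close>, \<open>b\<close> and \<open>1\<close> on \<open>c\<close>, \<open>d\<close>, and if \<open>f\<close>, \<open>g\<close> have weights \<open>p\<close>, \<open>q\<close>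
  then \<open>[fH, gH] = (q - p)fgH\<close>. Hence \<open>J\<close> is closed under products of eigenvectors of different weight
  (\<open>weight_product\<close>).

  Bracketing the generators with \<open>W\<close> and then with \<open>V\<close> puts \<open>a\<close>, \<open>b\<close>, \<open>c\<close>, \<open>d\<close> into \<open>J\<close>. A monomial of
  degree at least three splits as an entry times a monomial of smaller degree whose weight
  is different, which gives an induction (\<open>graded_monomial_multiplier\<close>). In degree two the products
  within one row do not split in this way; they arise by applying \<open>V\<close> or \<open>W\<close> to products of entries
  from different rows (\<open>quadratic_multiplier\<close>).

  Completeness is explicit. \<open>V\<close> and \<open>W\<close> are integrated by adding \<open>s\<close> times one row to the other. If
  \<open>X\<close> is one of them and \<open>X(X h) = 0\<close>, then \<open>h\<close> is affine along the orbits of \<open>X\<close>, so the flow of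
  \<open>hX\<close> is the same row operation with the parameter \<open>s\<close> solving the linear equation
  \<open>s' = h + k s\<close>, where \<open>h\<close> and \<open>k = X h\<close> are evaluated at the starting point
  (\<open>complete_mult_row_field\<close>). Here \<open>h\<close> is \<open>1\<close>, \<open>b + c\<close> or \<open>d\<close>.\<close>

section \<open>Derivations of the coordinate ring\<close>

lemma const_reg_0: "const_reg 0 = 0"
  by transfer (simp add: Const_def reg_cong_def)

lemma const_reg_diff: "const_reg (c - d) = const_reg c - const_reg d"
  using const_reg_add[of "c - d" d] by simp

lemma const_reg_uminus: "const_reg (- c) = - const_reg c"
  using const_reg_diff[of 0 c] by (simp add: const_reg_0)

lemma const_reg_2: "const_reg 2 = 2"
  using const_reg_add[of 1 1] by (simp add: const_reg_1)

lemma entry_det: "entry 1 1 * entry 2 2 - entry 1 2 * entry 2 1 = 1"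
  by transfer (simp add: reg_cong_def det_rel_def)

lemma mat_poly_monomial_induct:
  fixes p :: mat_poly
  assumes const: "\<And>c. P (Const c)"
    and add: "\<And>p q. P p \<Longrightarrow> P q \<Longrightarrow> P (p + q)"
    and var: "\<And>x p. P p \<Longrightarrow> P (Var x * p)"
  shows "P p"
proof (induction p rule: mat_poly_induct)
  case zero
  show ?case using const[of 0] by (simp add: Const_def)
next
  case (single m c)
  show ?case
  proof (induction m rule: update_induct)
    case const
    show ?case using assms(1)[of c] by (simp add: Const_def)
  next
    case (update m x k)
    have "Poly_Mapping.update x k m = Poly_Mapping.single x k + m"
      using update(1)
      by (intro poly_mapping_eqI)
         (auto simp: lookup_update lookup_add lookup_single when_def in_keys_iff)
    moreover have "P (Poly_Mapping.single (Poly_Mapping.single x k + m) c)"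
    proof (induction k)
      case 0
      show ?case using update.IH by simp
    next
      case (Suc k)
      have "Poly_Mapping.single (Poly_Mapping.single x (Suc k) + m) c =
          Var x * Poly_Mapping.single (Poly_Mapping.single x k + m) c"
        by (simp add: Var_def mult_single add.assoc[symmetric] single_add[symmetric])
      then show ?case using var[OF Suc] by simp
    qed
    ultimately show ?case by simp
  qed
next
  case (add p q)
  then show ?case by (rule assms(2))
qed

text \<open>The entries and the constants generate the coordinate ring, so this is the form in which statements
  about derivations, or about algebra homomorphisms, are reduced to the four entries.\<close>

lemma reg_induct [case_names const add entry]:
  assumes const: "\<And>c. P (const_reg c)"
    and add: "\<And>f g. P f \<Longrightarrow> P g \<Longrightarrow> P (f + g)"
    and entry: "\<And>i j f. P f \<Longrightarrow> P (entry i j * f)"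
  shows "P f"
proof -
  have "P (abs_reg p)" for p
  proof (induction p rule: mat_poly_monomial_induct)
    case (1 c)
    show ?case using const[of c] by (simp add: const_reg.abs_eq)
  next
    case (2 p q)
    show ?case using add[OF 2] by (simp add: plus_reg.abs_eq)
  next
    case (3 x p)
    show ?case using entry[OF 3, of "fst x" "snd x"]
      by (simp add: times_reg.abs_eq entry.abs_eq)
  qed
  then show ?thesis by (induction f) blast
qed

lemma vector_fieldsI:
  assumes "\<And>f g. X (f + g) = X f + X g" "\<And>c. X (const_reg c) = 0"
    "\<And>f g. X (f * g) = X f * g + f * X g"
  shows "X \<in> vector_fields"
proof -
  have "Vector_Spaces.linear scale_reg scale_reg X"
    by (unfold_locales; simp add: assms scale_reg_def)
  then show ?thesis by (simp add: vector_fields_def assms)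
qed

lemma vector_field_mult: "X \<in> vector_fields \<Longrightarrow> X (f * g) = X f * g + f * X g"
  by (simp add: vector_fields_def)

lemma vector_field_add: "X \<in> vector_fields \<Longrightarrow> X (f + g) = X f + X g"
  using module_hom.add[of scale_reg scale_reg X f g]
  by (simp add: vector_fields_def linear_iff_module_hom)

lemma vector_field_diff: "X \<in> vector_fields \<Longrightarrow> X (f - g) = X f - X g"
  using vector_field_add[of X "f - g" g] by simp

lemma vector_field_const:
  assumes "X \<in> vector_fields"
  shows "X (const_reg c) = 0"
proof -
  have "X 1 = 0" using vector_field_mult[OF assms, of 1 1] by simp
  moreover have "X (scale_reg c 1) = scale_reg c (X 1)"
    using assms module_hom.scale[of scale_reg scale_reg X c 1]
    by (simp add: vector_fields_def linear_iff_module_hom)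
  ultimately show ?thesis by (simp add: scale_reg_def)
qed

lemma vector_field_1: "X \<in> vector_fields \<Longrightarrow> X 1 = 0"
  using vector_field_const[of X 1] by (simp add: const_reg_1)

lemmas vector_field_simps =
  vector_field_mult vector_field_add vector_field_diff vector_field_const vector_field_1

lemma vector_fields_eqI:
  assumes X: "X \<in> vector_fields" and Y: "Y \<in> vector_fields"
    and eq: "\<And>i j. X (entry i j) = Y (entry i j)"
  shows "X = Y"
proof
  fix f
  show "X f = Y f"
    by (induction f rule: reg_induct)
       (simp_all add: vector_field_simps[OF X] vector_field_simps[OF Y] eq)
qed

lemma vector_fields_add:
  "X \<in> vector_fields \<Longrightarrow> Y \<in> vector_fields \<Longrightarrow> (\<lambda>f. X f + Y f) \<in> vector_fields"
  by (rule vector_fieldsI) (simp_all add: vector_field_simps algebra_simps)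

lemma mult_field_vector_fields: "X \<in> vector_fields \<Longrightarrow> mult_field h X \<in> vector_fields"
  by (rule vector_fieldsI) (simp_all add: mult_field_def vector_field_simps algebra_simps)

lemma lie_bracket_vector_fields:
  assumes "X \<in> vector_fields" "Y \<in> vector_fields"
  shows "lie_bracket X Y \<in> vector_fields"
  by (rule vector_fieldsI)
     (simp_all add: lie_bracket_def assms[THEN vector_field_mult] assms[THEN vector_field_add]
        assms[THEN vector_field_const] assms[THEN vector_field_const[of _ 0, unfolded const_reg_0]]
        algebra_simps)

lemma lie_subalgebra_vector_fields: "lie_subalgebra vector_fields"
proof -
  have "(\<lambda>f. 0) \<in> vector_fields" by (rule vector_fieldsI) simp_all
  moreover have "(\<lambda>f. scale_reg c (X f)) \<in> vector_fields" if "X \<in> vector_fields" for c X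
    using mult_field_vector_fields[OF that] by (simp add: scale_reg_def mult_field_def)
  ultimately show ?thesis
    by (simp add: lie_subalgebra_def vector_fields_add lie_bracket_vector_fields)
qed

lemma lie_bracket_mult_field:
  assumes "X \<in> vector_fields" "Y \<in> vector_fields"
  shows "lie_bracket (mult_field f X) (mult_field g Y) =
    (\<lambda>u. f * X g * Y u - g * Y f * X u + f * g * lie_bracket X Y u)"
  by (rule ext) (simp add: lie_bracket_def mult_field_def assms[THEN vector_field_mult] algebra_simps)

section \<open>The frame of right-invariant fields\<close>

lemma field_V_vector_field: "field_V \<in> vector_fields"
  by (rule vector_fieldsI;
      transfer; simp add: reg_cong_def poly_V_def partial_add partial_mult partial_Const algebra_simps)

lemma field_W_vector_field: "field_W \<in> vector_fields"
  by (rule vector_fieldsI;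
      transfer; simp add: reg_cong_def poly_W_def partial_add partial_mult partial_Const algebra_simps)

definition field_H :: "reg \<Rightarrow> reg" where
  "field_H = lie_bracket field_V field_W"

lemma field_H_vector_field: "field_H \<in> vector_fields"
  unfolding field_H_def
  by (rule lie_bracket_vector_fields[OF field_V_vector_field field_W_vector_field])

lemmas frame_vector_fields = field_V_vector_field field_W_vector_field field_H_vector_field

lemma field_V_row: "field_V (entry 1 j) = entry 2 j" "field_V (entry 2 j) = 0"
  using exhaust_2[of j] by (auto simp: field_V_entry)

lemma field_W_row: "field_W (entry 1 j) = 0" "field_W (entry 2 j) = entry 1 j"
  using exhaust_2[of j] by (auto simp: field_W_entry)

lemma field_H_row: "field_H (entry 1 j) = - entry 1 j" "field_H (entry 2 j) = entry 2 j"
  using vector_field_const[OF field_V_vector_field, of 0] vector_field_const[OF field_W_vector_field, of 0]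
  by (simp_all add: field_H_def lie_bracket_def field_V_row field_W_row const_reg_0)

lemma bracket_H:
  shows "lie_bracket field_V field_H = mult_field (- 2) field_V"
    and "lie_bracket field_W field_H = mult_field 2 field_W"
    and "lie_bracket field_H field_V = mult_field 2 field_V"
proof -
  note zero = frame_vector_fields[THEN vector_field_const[of _ 0, unfolded const_reg_0]]
  note minus = frame_vector_fields[THEN vector_field_diff[of _ 0], unfolded zero, simplified]
  have *: "lie_bracket X Y = mult_field h Z"
    if "X \<in> vector_fields" "Y \<in> vector_fields" "Z \<in> vector_fields"
      "\<And>j. lie_bracket X Y (entry 1 j) = h * Z (entry 1 j)"
      "\<And>j. lie_bracket X Y (entry 2 j) = h * Z (entry 2 j)" for X Y Z h
  proof (rule vector_fields_eqI)
    fix i j :: 2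
    show "lie_bracket X Y (entry i j) = mult_field h Z (entry i j)"
      using exhaust_2[of i] that(4,5) by (auto simp: mult_field_def)
  qed (simp_all add: that lie_bracket_vector_fields mult_field_vector_fields)
  show "lie_bracket field_V field_H = mult_field (- 2) field_V"
    "lie_bracket field_W field_H = mult_field 2 field_W"
    "lie_bracket field_H field_V = mult_field 2 field_V"
    by (rule *; simp add: frame_vector_fields lie_bracket_def
          field_V_row field_W_row field_H_row zero minus)+
qed

text \<open>A derivation \<open>X\<close> sends the matrix \<open>M\<close> of entries to \<open>E M\<close> with \<open>E = X(M) M\<^sup>-\<^sup>1\<close>, and \<open>M\<^sup>-\<^sup>1\<close> is the
  adjugate because the determinant is one. Differentiating the determinant shows that \<open>E\<close> is
  traceless, so \<open>E\<close> is a combination of the matrices of \<open>V\<close>, \<open>W\<close> and \<open>H\<close>; its coefficients are the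
  entries of \<open>E\<close>.\<close>

lemma vector_field_frame:
  assumes X: "X \<in> vector_fields"
  obtains p q r where "X = (\<lambda>f. p * field_V f + q * field_W f + r * field_H f)"
proof
  let ?a = "entry 1 1" and ?b = "entry 1 2" and ?c = "entry 2 1" and ?d = "entry 2 2"
  let ?p = "?a * X ?b - ?b * X ?a" and ?q = "?d * X ?c - ?c * X ?d" and ?r = "?a * X ?d - ?b * X ?c"
  let ?Y = "\<lambda>f. ?p * field_V f + ?q * field_W f + ?r * field_H f"
  let ?D = "?a * ?d - ?b * ?c" and ?T = "X ?a * ?d + ?a * X ?d - (X ?b * ?c + ?b * X ?c)"
  have D: "?D = 1" by (rule entry_det)
  have "X ?D = 0"
    unfolding D by (rule vector_field_1[OF X])
  then have T: "?T = 0"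
    by (simp only: vector_field_diff[OF X] vector_field_mult[OF X])
  show "X = ?Y"
  proof (rule vector_fields_eqI[OF X])
    show "?Y \<in> vector_fields"
      using frame_vector_fields[THEN mult_field_vector_fields]
      unfolding mult_field_def by (intro vector_fields_add)
    fix i j :: 2
    \<comment> \<open>The coefficient of \<open>H\<close> is the lower diagonal entry of \<open>E\<close>; in the first row its negative is
      needed, whence the correction by the trace.\<close>
    have "?Y ?a = ?D * X ?a - ?a * ?T" "?Y ?b = ?D * X ?b - ?b * ?T"
      "?Y ?c = ?D * X ?c" "?Y ?d = ?D * X ?d"
      unfolding field_V_row field_W_row field_H_row by (simp_all add: algebra_simps)
    then have "X ?a = ?Y ?a" "X ?b = ?Y ?b" "X ?c = ?Y ?c" "X ?d = ?Y ?d"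
      unfolding D T by simp_all
    then show "X (entry i j) = ?Y (entry i j)"
      using exhaust_2[of i] exhaust_2[of j] by fastforce
  qed
qed

section \<open>The generated Lie algebra\<close>

text \<open>Monomials in the entries with their degree and their weight, the eigenvalue of \<open>H\<close>. The
  coordinate ring is not graded by degree, because \<open>ad - bc = 1\<close> is not homogeneous, so the predicate
  carries the degree along instead of reading it off the function.\<close>

inductive graded_monomial :: "nat \<Rightarrow> int \<Rightarrow> reg \<Rightarrow> bool" where
  one: "graded_monomial 0 0 1"
| row1: "graded_monomial n w u \<Longrightarrow> graded_monomial (Suc n) (w - 1) (entry 1 j * u)"
| row2: "graded_monomial n w u \<Longrightarrow> graded_monomial (Suc n) (w + 1) (entry 2 j * u)"

lemma graded_monomial_weight:
  assumes "graded_monomial n w u"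
  shows "field_H u = const_reg (of_int w) * u"
  using assms
proof induction
  case one
  show ?case by (simp add: vector_field_1[OF field_H_vector_field] const_reg_0)
qed (simp_all add: vector_field_mult[OF field_H_vector_field] field_H_row const_reg_add
       const_reg_diff const_reg_1 algebra_simps)

lemma graded_monomial_bound:
  assumes "graded_monomial n w u"
  shows "- int n \<le> w \<and> w \<le> int n"
  using assms by induction auto

lemma graded_monomial_Suc:
  assumes "graded_monomial (Suc n) w u"
  obtains i j w' u' where "u = entry i j * u'" "graded_monomial n w' u'"
  using assms by cases blast+

text \<open>Only a product of \<open>n\<close> entries of the second row has weight \<open>n\<close>; below this weight some factor comes from
  the first row, and it can be moved to the front.\<close>

lemma graded_monomial_row1_factor:
  assumes "graded_monomial n w u" "w < int n"
  shows "\<exists>m j u'. n = Suc m \<and> u = entry 1 j * u' \<and> graded_monomial m (w + 1) u'"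
  using assms
proof induction
  case (row1 n w u j)
  then show ?case by auto
next
  case (row2 n w u j)
  then obtain m k u' where "n = Suc m" "u = entry 1 k * u'" "graded_monomial m (w + 1) u'"
    by auto
  then show ?case
    using graded_monomial.row2[of m "w + 1" u' j]
    by (auto intro!: exI[of _ k] exI[of _ "entry 2 j * u'"])
qed simp

lemma graded_monomial_row2_factor:
  assumes "graded_monomial n w u" "- int n < w"
  shows "\<exists>m j u'. n = Suc m \<and> u = entry 2 j * u' \<and> graded_monomial m (w - 1) u'"
  using assms
proof induction
  case (row2 n w u j)
  then show ?case by auto
next
  case (row1 n w u j)
  then obtain m k u' where "n = Suc m" "u = entry 2 k * u'" "graded_monomial m (w - 1) u'"
    by auto
  then show ?case
    using graded_monomial.row1[of m "w - 1" u' j]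
    by (auto intro!: exI[of _ k] exI[of _ "entry 1 j * u'"])
qed simp

lemma span_graded_monomials: "f \<in> reg.span {u. \<exists>n w. graded_monomial n w u}" (is "_ \<in> reg.span ?M")
proof (induction f rule: reg_induct)
  case (const c)
  have "scale_reg c 1 \<in> reg.span ?M"
    by (intro reg.span_scale reg.span_base) (auto intro: graded_monomial.one)
  moreover have "scale_reg c 1 = const_reg c" by (simp add: scale_reg_def)
  ultimately show ?case by (simp only:)
next
  case (add f g)
  then show ?case by (rule reg.span_add)
next
  case (entry i j f)
  have closed: "entry i j * u \<in> ?M" if "u \<in> ?M" for u
    using that exhaust_2[of i] by (auto intro: graded_monomial.row1 graded_monomial.row2)
  from entry show ?case
  proof (induction rule: reg.span_induct_alt)
    case base
    show ?case by (simp add: reg.span_zero)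
  next
    case (step c x y)
    have "scale_reg c (entry i j * x) + entry i j * y \<in> reg.span ?M"
      by (rule reg.span_add[OF reg.span_scale[OF reg.span_base[OF closed[OF step(1)]]] step(2)])
    moreover have "scale_reg c (entry i j * x) + entry i j * y = entry i j * (scale_reg c x + y)"
      by (simp add: scale_reg_def algebra_simps)
    ultimately show ?case by (simp only:)
  qed
qed

locale generated_subalgebra =
  fixes L :: "(reg \<Rightarrow> reg) set"
  assumes subalgebra: "lie_subalgebra L"
    and V_mem: "field_V \<in> L"
    and W_mem: "field_W \<in> L"
    and bcW_mem: "mult_field (entry 1 2 + entry 2 1) field_W \<in> L"
    and dW_mem: "mult_field (entry 2 2) field_W \<in> L"
begin

lemma add_mem: "X \<in> L \<Longrightarrow> Y \<in> L \<Longrightarrow> (\<lambda>u. X u + Y u) \<in> L"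
  and scale_mem: "X \<in> L \<Longrightarrow> (\<lambda>u. const_reg c * X u) \<in> L"
  and bracket_mem: "X \<in> L \<Longrightarrow> Y \<in> L \<Longrightarrow> lie_bracket X Y \<in> L"
  using subalgebra by (simp_all add: lie_subalgebra_def scale_reg_def)

lemma diff_mem: "X \<in> L \<Longrightarrow> Y \<in> L \<Longrightarrow> (\<lambda>u. X u - Y u) \<in> L"
  using add_mem[of X "\<lambda>u. const_reg (- 1) * Y u"] scale_mem[of Y "- 1"]
  by (simp add: const_reg_uminus const_reg_1)

lemma H_mem: "field_H \<in> L"
  unfolding field_H_def by (rule bracket_mem[OF V_mem W_mem])

lemma unscale_mem:
  assumes "c \<noteq> 0" "mult_field (const_reg c * h) X \<in> L"
  shows "mult_field h X \<in> L"
proof -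
  have "const_reg (inverse c) * const_reg c = 1"
    using assms(1) by (simp flip: const_reg_mult add: const_reg_1)
  then have "const_reg (inverse c) * (const_reg c * h * X u) = h * X u" for u
    by (metis mult.assoc mult_1)
  with scale_mem[OF assms(2), of "inverse c"] show ?thesis
    by (simp add: mult_field_def)
qed

definition multipliers :: "(reg \<Rightarrow> reg) \<Rightarrow> reg set" where
  "multipliers X = {h. mult_field h X \<in> L}"

lemma multipliers_add: "f \<in> multipliers X \<Longrightarrow> g \<in> multipliers X \<Longrightarrow> f + g \<in> multipliers X"
  using add_mem[of "mult_field f X" "mult_field g X"]
  by (simp add: multipliers_def mult_field_def distrib_right)

lemma multipliers_scale: "f \<in> multipliers X \<Longrightarrow> const_reg c * f \<in> multipliers X"
  using scale_mem[of "mult_field f X" c]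
  by (simp add: multipliers_def mult_field_def mult.assoc)

lemma multipliers_diff: "f \<in> multipliers X \<Longrightarrow> g \<in> multipliers X \<Longrightarrow> f - g \<in> multipliers X"
  using diff_mem[of "mult_field f X" "mult_field g X"]
  by (simp add: multipliers_def mult_field_def left_diff_distrib)

lemma multipliers_0: "X \<in> L \<Longrightarrow> 0 \<in> multipliers X"
  using scale_mem[of X 0] by (simp add: multipliers_def mult_field_def const_reg_0)

text \<open>By \<open>[X, hH] = X(h)H + k hX\<close>, the two statements differ by an element of \<open>L\<close>.\<close>

lemma derivative_multiplier_iff:
  assumes X: "X \<in> vector_fields" "X \<in> L"
    and eigen: "lie_bracket X field_H = mult_field (const_reg k) X" "k \<noteq> 0"
    and h: "h \<in> multipliers field_H"
  shows "X h \<in> multipliers field_H \<longleftrightarrow> h \<in> multipliers X"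
proof -
  have eq: "lie_bracket X (mult_field h field_H) =
      (\<lambda>u. mult_field (X h) field_H u + mult_field (const_reg k * h) X u)"
  proof
    fix u
    have "X (field_H u) - field_H (X u) = const_reg k * X u"
      using fun_cong[OF eigen(1), of u] by (simp add: lie_bracket_def mult_field_def)
    then have "h * X (field_H u) - h * field_H (X u) = const_reg k * h * X u"
      by (metis mult.assoc mult.left_commute right_diff_distrib)
    then show "lie_bracket X (mult_field h field_H) u =
        mult_field (X h) field_H u + mult_field (const_reg k * h) X u"
      by (simp add: lie_bracket_def mult_field_def vector_field_mult[OF X(1)])
  qed
  have B: "lie_bracket X (mult_field h field_H) \<in> L"
    using h X(2) by (intro bracket_mem) (simp_all add: multipliers_def)
  show ?thesis
  proof
    assume "X h \<in> multipliers field_H"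
    then have "mult_field (X h) field_H \<in> L" by (simp add: multipliers_def)
    from diff_mem[OF B this] have "mult_field (const_reg k * h) X \<in> L" by (simp add: eq)
    then show "h \<in> multipliers X" by (simp add: multipliers_def unscale_mem[OF eigen(2)])
  next
    assume "h \<in> multipliers X"
    then have "mult_field (const_reg k * h) X \<in> L"
      using multipliers_scale by (simp add: multipliers_def)
    from diff_mem[OF B this] show "X h \<in> multipliers field_H"
      by (simp add: eq multipliers_def)
  qed
qed

lemma field_V_multiplier_iff:
  "h \<in> multipliers field_H \<Longrightarrow> field_V h \<in> multipliers field_H \<longleftrightarrow> h \<in> multipliers field_V"
  by (rule derivative_multiplier_iff[OF field_V_vector_field V_mem, of "- 2"])
     (simp_all add: bracket_H const_reg_uminus const_reg_2)

lemma field_W_multiplier_iff: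
  "h \<in> multipliers field_H \<Longrightarrow> field_W h \<in> multipliers field_H \<longleftrightarrow> h \<in> multipliers field_W"
  by (rule derivative_multiplier_iff[OF field_W_vector_field W_mem, of 2])
     (simp_all add: bracket_H const_reg_2)

lemma weight_product:
  assumes f: "f \<in> multipliers field_H" "field_H f = const_reg p * f"
    and g: "g \<in> multipliers field_H" "field_H g = const_reg q * g"
    and "p \<noteq> q"
  shows "f * g \<in> multipliers field_H"
proof -
  have "lie_bracket field_H field_H = (\<lambda>u. 0)" by (simp add: lie_bracket_def)
  then have "lie_bracket (mult_field f field_H) (mult_field g field_H) =
      mult_field (const_reg (q - p) * (f * g)) field_H"
    unfolding lie_bracket_mult_field[OF frame_vector_fields(3,3)] f(2) g(2)
    by (simp add: mult_field_def const_reg_diff algebra_simps)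
  moreover have "lie_bracket (mult_field f field_H) (mult_field g field_H) \<in> L"
    using f(1) g(1) by (intro bracket_mem) (simp_all add: multipliers_def)
  ultimately show ?thesis
    using \<open>p \<noteq> q\<close> by (simp add: multipliers_def unscale_mem[of "q - p"])
qed

text \<open>The only place where the generators \<open>(b + c)W\<close> and \<open>dW\<close> are used. Since \<open>[W, hW] = W(h)W\<close>, \<open>dW\<close> yields
  \<open>bW\<close>; subtracting this from \<open>(b + c)W\<close> leaves \<open>cW\<close>, which in turn yields \<open>aW\<close>.\<close>

lemma entry_multiplier_W: "entry i j \<in> multipliers field_W"
proof -
  have W: "field_W h \<in> multipliers field_W" if "h \<in> multipliers field_W" for h
  proof -
    have "lie_bracket field_W (mult_field h field_W) = mult_field (field_W h) field_W"
      by (rule ext) (simp add: lie_bracket_def mult_field_def vector_field_mult[OF field_W_vector_field])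
    with bracket_mem[OF W_mem, of "mult_field h field_W"] that show ?thesis
      by (simp add: multipliers_def)
  qed
  have d: "entry 2 2 \<in> multipliers field_W"
    using dW_mem by (simp add: multipliers_def)
  then have b: "entry 1 2 \<in> multipliers field_W"
    using W[OF d] by (simp add: field_W_row)
  have c: "entry 2 1 \<in> multipliers field_W"
    using multipliers_diff[OF _ b, of "entry 1 2 + entry 2 1"] bcW_mem
    by (simp add: multipliers_def)
  then have "entry 1 1 \<in> multipliers field_W"
    using W[OF c] by (simp add: field_W_row)
  with b c d show ?thesis
    using exhaust_2[of i] exhaust_2[of j] by auto
qed

text \<open>For an entry \<open>e\<close>, \<open>[V, eW] = V(e)W + eH\<close>, and \<open>V(e)\<close> is again an entry or zero.\<close>

lemma entry_multiplier_H: "entry i j \<in> multipliers field_H"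
proof -
  have V: "field_V (entry i j) \<in> multipliers field_W"
    using exhaust_2[of i] by (auto simp: field_V_row entry_multiplier_W multipliers_0[OF W_mem])
  have eq: "lie_bracket field_V (mult_field (entry i j) field_W) =
      (\<lambda>u. mult_field (field_V (entry i j)) field_W u + mult_field (entry i j) field_H u)"
    by (rule ext) (simp add: lie_bracket_def mult_field_def field_H_def
        vector_field_mult[OF field_V_vector_field] algebra_simps)
  have "lie_bracket field_V (mult_field (entry i j) field_W) \<in> L"
    using entry_multiplier_W by (intro bracket_mem V_mem) (simp add: multipliers_def)
  from diff_mem[OF this, of "mult_field (field_V (entry i j)) field_W"] V show ?thesis
    by (simp add: eq multipliers_def)
qed

lemma entry_multiplier_V: "entry i j \<in> multipliers field_V"
proof -
  have "field_V (entry i j) \<in> multipliers field_H"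
    using exhaust_2[of i] by (auto simp: field_V_row entry_multiplier_H multipliers_0[OF H_mem])
  then show ?thesis using field_V_multiplier_iff[OF entry_multiplier_H] by simp
qed

text \<open>Two entries of the same row have the same weight, so their product needs another source. For \<open>f\<close> in the
  first row and \<open>g\<close> in the second, \<open>[gH, fV] = fgV\<close> and \<open>[gW, fH] = fgW\<close>; hence \<open>V(fg)\<close> and \<open>W(fg)\<close> are
  multipliers of \<open>H\<close>. These are exactly the products within the second and within the first row.\<close>

lemma quadratic_multiplier: "entry i j * entry k l \<in> multipliers field_H"
proof -
  have mixed: "entry 1 j * entry 2 l \<in> multipliers field_H" for j l
    by (rule weight_product[of _ "- 1" _ 1])
       (simp_all add: entry_multiplier_H field_H_row const_reg_uminus const_reg_1)
  have mem: "mult_field (entry i j) X \<in> L" if "X \<in> {field_V, field_W, field_H}" for i j X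
    using that entry_multiplier_H entry_multiplier_V entry_multiplier_W
    by (auto simp: multipliers_def)
  have lower: "entry 2 j * entry 2 l \<in> multipliers field_H" for j l
  proof -
    have "lie_bracket (mult_field (entry 2 l) field_H) (mult_field (entry 1 j) field_V) =
        mult_field (entry 1 j * entry 2 l) field_V"
      unfolding lie_bracket_mult_field[OF frame_vector_fields(3,1)] bracket_H
      by (simp add: mult_field_def field_H_row field_V_row algebra_simps)
    then have "entry 1 j * entry 2 l \<in> multipliers field_V"
      using bracket_mem[OF mem mem, of field_H field_V "2" l 1 j] by (simp add: multipliers_def)
    then have "field_V (entry 1 j * entry 2 l) \<in> multipliers field_H"
      using field_V_multiplier_iff[OF mixed] by simp
    then show ?thesis
      by (simp add: vector_field_mult[OF field_V_vector_field] field_V_row)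
  qed
  have upper: "entry 1 j * entry 1 l \<in> multipliers field_H" for j l
  proof -
    have "lie_bracket (mult_field (entry 2 l) field_W) (mult_field (entry 1 j) field_H) =
        mult_field (entry 1 j * entry 2 l) field_W"
      unfolding lie_bracket_mult_field[OF frame_vector_fields(2,3)] bracket_H
      by (simp add: mult_field_def field_H_row field_W_row algebra_simps)
    then have "entry 1 j * entry 2 l \<in> multipliers field_W"
      using bracket_mem[OF mem mem, of field_W field_H "2" l 1 j] by (simp add: multipliers_def)
    then have "field_W (entry 1 j * entry 2 l) \<in> multipliers field_H"
      using field_W_multiplier_iff[OF mixed] by simp
    then show ?thesis
      by (simp add: vector_field_mult[OF field_W_vector_field] field_W_row)
  qed
  show ?thesis
    using exhaust_2[of i] exhaust_2[of k] mixed[of j l] mixed[of l j] lower upper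
    by (auto simp: mult.commute)
qed

text \<open>A first-row factor splits off with a cofactor of different weight unless \<open>w = -2\<close>, a second-row factor
  unless \<open>w = 2\<close>. From degree three on, weight \<open>2\<close> or \<open>-2\<close> forces factors from both rows, so one of
  the two splittings is always available.\<close>

lemma graded_monomial_multiplier:
  "graded_monomial n w u \<Longrightarrow> u \<in> multipliers field_H"
proof (induction n arbitrary: w u rule: less_induct)
  case (less n)
  consider "n = 0" | "n = 1" | "n = 2" | "n \<ge> 3" by linarith
  then show ?case
  proof cases
    case 1
    then have "u = 1" using less.prems by (auto elim: graded_monomial.cases)
    then show ?thesis using H_mem by (simp add: multipliers_def mult_field_def)
  next
    case 2
    then obtain i j where "u = entry i j"
      using less.prems by (auto elim!: graded_monomial_Suc elim: graded_monomial.cases)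
    then show ?thesis by (simp add: entry_multiplier_H)
  next
    case 3
    then have "graded_monomial (Suc (Suc 0)) w u" using less.prems by (simp add: numeral_2_eq_2)
    then obtain i j k l where "u = entry i j * entry k l"
      by (elim graded_monomial_Suc) (auto elim: graded_monomial.cases)
    then show ?thesis by (simp add: quadratic_multiplier)
  next
    case 4
    have split: "e * v \<in> multipliers field_H"
      if "graded_monomial m w' v" "m < n" "e \<in> multipliers field_H"
        "field_H e = const_reg (of_int s) * e" "s \<noteq> w'" for e v m w' s
      using that less.IH[of m w' v] graded_monomial_weight[of m w' v]
      by (intro weight_product[of e "of_int s" v "of_int w'"]) auto
    note w = graded_monomial_bound[OF less.prems]
    show ?thesis
    proof (cases "w < int n \<and> w \<noteq> - 2")
      case True
      then obtain m j v where v: "n = Suc m" "u = entry 1 j * v" "graded_monomial m (w + 1) v"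
        using graded_monomial_row1_factor[OF less.prems] by blast
      show ?thesis unfolding v(2)
        by (rule split[OF v(3), of _ "- 1"])
           (use True in \<open>simp_all add: v(1) entry_multiplier_H field_H_row const_reg_uminus const_reg_1\<close>)
    next
      case False
      then have "- int n < w" using w 4 by linarith
      then obtain m j v where v: "n = Suc m" "u = entry 2 j * v" "graded_monomial m (w - 1) v"
        using graded_monomial_row2_factor[OF less.prems] by blast
      show ?thesis unfolding v(2)
        by (rule split[OF v(3), of _ 1])
           (use False w 4 in \<open>auto simp: v(1) entry_multiplier_H field_H_row const_reg_1\<close>)
    qed
  qed
qed

lemma multipliers_H: "h \<in> multipliers field_H"
  using span_graded_monomials[of h]
proof (induction rule: reg.span_induct_alt)
  case base
  show ?case by (rule multipliers_0[OF H_mem])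
next
  case (step c x y)
  then show ?case
    by (auto simp: scale_reg_def intro: multipliers_add multipliers_scale graded_monomial_multiplier)
qed

lemma multipliers_frame: "h \<in> multipliers field_V" "h \<in> multipliers field_W"
  using field_V_multiplier_iff field_W_multiplier_iff multipliers_H by blast+

lemma vector_fields_subset: "vector_fields \<subseteq> L"
proof
  fix X assume "X \<in> vector_fields"
  then obtain p q r where "X = (\<lambda>f. p * field_V f + q * field_W f + r * field_H f)"
    by (rule vector_field_frame)
  moreover have "(\<lambda>f. p * field_V f) \<in> L" "(\<lambda>f. q * field_W f) \<in> L" "(\<lambda>f. r * field_H f) \<in> L"
    using multipliers_frame multipliers_H by (simp_all add: multipliers_def mult_field_def)
  ultimately show "X \<in> L" by (simp add: add_mem)
qed

end

section \<open>Flows by row operations\<close>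

lemma reg_eval_simps:
  "reg_eval x (f + g) = reg_eval x f + reg_eval x g"
  "reg_eval x (f * g) = reg_eval x f * reg_eval x g"
  "reg_eval x (const_reg c) = c"
  by (transfer; simp add: poly_eval_add poly_eval_mult poly_eval_Const)+

lemma reg_eval_0: "reg_eval x 0 = 0"
  using reg_eval_simps(3)[of x 0] by (simp add: const_reg_0)

text \<open>In the type \<open>2\<close> of row indices, \<open>p + 1\<close> is the row other than \<open>p\<close>.\<close>

lemma three_eq_one: "(3::2) = 1"
proof -
  have "(3::2) \<noteq> 2"
  proof
    assume "(3::2) = 2"
    then have "(3::2) - 2 = 2 - 2" by (rule arg_cong)
    then show False by simp
  qed
  then show ?thesis using exhaust_2[of 3] by blast
qed

lift_definition add_row :: "2 \<Rightarrow> complex \<Rightarrow> sl2 \<Rightarrow> sl2" is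
  "\<lambda>i s M. \<chi> p q. if p = i then M $ p $ q + s * M $ (p + 1) $ q else M $ p $ q"
proof -
  fix i s and M :: "complex^2^2"
  assume "det M = 1"
  then show "det (\<chi> p q. if p = i then M $ p $ q + s * M $ (p + 1) $ q else M $ p $ q) = 1"
    using exhaust_2[of i] by (auto simp: det_2 three_eq_one algebra_simps)
qed

lemma reg_eval_entry_add_row:
  "reg_eval (add_row i s x) (entry p q) =
     (if p = i then reg_eval x (entry p q) + s * reg_eval x (entry (p + 1) q)
      else reg_eval x (entry p q))"
  by transfer (simp add: poly_eval_Var)

lemma add_row_0: "add_row i 0 x = x"
  by transfer (simp add: vec_eq_iff)

text \<open>The derivation of the coordinate ring induced by the one-parameter group \<open>add_row i\<close>.\<close>

definition row_field :: "2 \<Rightarrow> (reg \<Rightarrow> reg) \<Rightarrow> bool" where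
  "row_field i X \<longleftrightarrow> X \<in> vector_fields \<and>
     (\<forall>p q. X (entry p q) = (if p = i then entry (p + 1) q else 0))"

lemma row_field_V: "row_field 1 field_V"
  unfolding row_field_def forall_2 by (simp add: field_V_row field_V_vector_field)

lemma row_field_W: "row_field 2 field_W"
  unfolding row_field_def forall_2 by (simp add: three_eq_one field_W_row field_W_vector_field)

lemma add_row_flow:
  assumes X: "row_field i X"
  shows "((\<lambda>s. reg_eval (add_row i s x) f) has_field_derivative reg_eval (add_row i t x) (X f)) (at t)"
proof (induction f rule: reg_induct)
  case (const c)
  show ?case using X by (simp add: row_field_def vector_field_const reg_eval_simps reg_eval_0)
next
  case (add f g)
  then show ?case using X
    by (auto simp: row_field_def vector_field_add reg_eval_simps intro!: derivative_eq_intros)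
next
  case (entry p q f)
  have "((\<lambda>s. reg_eval (add_row i s x) (entry p q)) has_field_derivative
      reg_eval (add_row i t x) (X (entry p q))) (at t)"
    using X by (auto simp: row_field_def reg_eval_entry_add_row reg_eval_0 intro!: derivative_eq_intros)
  from DERIV_mult[OF this entry] show ?case using X
    by (simp add: row_field_def vector_field_mult reg_eval_simps algebra_simps)
qed

text \<open>Along the flow of \<open>X\<close> the function \<open>X h\<close> is constant and is the derivative of \<open>h\<close>.\<close>

lemma reg_eval_add_row:
  assumes X: "row_field i X" and h: "X (X h) = 0"
  shows "reg_eval (add_row i s x) h = reg_eval x h + s * reg_eval x (X h)"
proof -
  have const: "F s = F 0" if "\<And>t. (F has_field_derivative 0) (at t)" for F :: "complex \<Rightarrow> complex" and s
    using has_field_derivative_zero_constant[of UNIV F] that by auto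
  have "((\<lambda>s. reg_eval (add_row i s x) (X h)) has_field_derivative 0) (at t)" for t
    using add_row_flow[OF X, of x "X h"] by (simp add: h reg_eval_0)
  from const[OF this] have k: "reg_eval (add_row i t x) (X h) = reg_eval x (X h)" for t
    by (simp add: add_row_0)
  have "((\<lambda>s. reg_eval (add_row i s x) h - s * reg_eval x (X h)) has_field_derivative 0) (at t)" for t
    by (auto intro!: derivative_eq_intros add_row_flow[OF X] simp: k)
  from const[OF this] show ?thesis by (simp add: add_row_0 algebra_simps)
qed

text \<open>With \<open>k = X h\<close> at the starting point \<open>x\<close>, time \<open>t\<close> of the flow of \<open>hX\<close> is the row operation with
  parameter \<open>s = h(x) (exp(kt) - 1)/k\<close>: its speed is \<open>h(x) exp(kt) = h(x) + s k\<close>, which is the value of \<open>h\<close> at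
  the point reached.\<close>

lemma complete_mult_row_field:
  assumes X: "row_field i X" and h: "X (X h) = 0"
  shows "complete_field (mult_field h X)"
proof -
  \<comment> \<open>At \<open>k = 0\<close> the quotient \<open>(exp(kt) - 1)/k\<close> is replaced by its limit \<open>t\<close>.\<close>
  define E :: "complex \<Rightarrow> complex \<Rightarrow> complex" where
    "E k t = (if k = 0 then t else (exp (k * t) - 1) / k)" for k t
  have E': "(E k has_field_derivative exp (k * t)) (at t)" for k t
    by (cases "k = 0") (auto simp: E_def[abs_def] intro!: derivative_eq_intros)
  have kE: "1 + E k t * k = exp (k * t)" for k t
    by (simp add: E_def)
  define S where "S t x = reg_eval x h * E (reg_eval x (X h)) t" for t x
  have "((\<lambda>s. reg_eval (add_row i (S s x) x) f) has_field_derivative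
      reg_eval (add_row i (S t x) x) (mult_field h X f)) (at t)" for t x f
  proof -
    let ?k = "reg_eval x (X h)"
    have "reg_eval (add_row i (S t x) x) h = reg_eval x h * (1 + E ?k t * ?k)"
      unfolding reg_eval_add_row[OF X h] by (simp add: S_def algebra_simps)
    then have speed: "reg_eval (add_row i (S t x) x) h = reg_eval x h * exp (?k * t)"
      by (simp only: kE)
    have "((\<lambda>s. S s x) has_field_derivative reg_eval x h * exp (?k * t)) (at t)"
      unfolding S_def by (rule DERIV_cmult[OF E'])
    from DERIV_chain2[OF add_row_flow[OF X] this] show ?thesis
      by (simp add: mult_field_def reg_eval_simps speed mult.commute)
  qed
  moreover have "add_row i (S 0 x) x = x" for x
    by (simp add: S_def E_def add_row_0)
  ultimately show ?thesis
    unfolding complete_field_def by (intro exI[of _ "\<lambda>t x. add_row i (S t x) x"]) blast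
qed

lemma complete_row_field:
  assumes "row_field i X"
  shows "complete_field X"
proof -
  have "X (X 1) = 0"
    using assms vector_field_1[of X] vector_field_const[of X 0] by (simp add: row_field_def const_reg_0)
  from complete_mult_row_field[OF assms this] show ?thesis by (simp add: mult_field_def)
qed

theorem theorem14:
  shows "complete_field field_V \<and>
    complete_field field_W \<and>
    complete_field (mult_field (entry 1 2 + entry 2 1) field_W) \<and>
    complete_field (mult_field (entry 2 2) field_W) \<and>
    lie_generated {field_V, field_W,
      mult_field (entry 1 2 + entry 2 1) field_W, mult_field (entry 2 2) field_W} = vector_fields"
proof -
  let ?S = "{field_V, field_W,
      mult_field (entry 1 2 + entry 2 1) field_W, mult_field (entry 2 2) field_W}"
  have "lie_generated ?S \<subseteq> vector_fields"
    unfolding lie_generated_def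
    using lie_subalgebra_vector_fields frame_vector_fields
    by (intro Inter_lower) (simp add: mult_field_vector_fields)
  moreover have "vector_fields \<subseteq> L" if "lie_subalgebra L" "?S \<subseteq> L" for L
    by (rule generated_subalgebra.vector_fields_subset, unfold_locales) (use that in auto)
  then have "vector_fields \<subseteq> lie_generated ?S"
    unfolding lie_generated_def by blast
  moreover have "field_W (field_W (entry 1 2 + entry 2 1)) = 0" "field_W (field_W (entry 2 2)) = 0"
    by (simp_all add: vector_field_add[OF field_W_vector_field] field_W_row)
  ultimately show ?thesis
    by (simp add: complete_row_field[OF row_field_V] complete_row_field[OF row_field_W]
        complete_mult_row_field[OF row_field_W])
qed

end
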